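(* Let $X,Y$ be metric spaces and let $f,g:X\to Y$ be two uniformly continuous maps. Suppose $f$ and $g$ are uniformly homotopic, i.e. there is a family of uniformly continuous maps $f_t:X\to Y$, $t\in[0,1]$, such that $f_0=f$, $f_1=g$ and the associated map $F:X\times[0,1]\to Y$, $F(x,t)=f_t(x)$, is uniformly continuous. Then $$f_*^{lc}=g_*^{lc}:H_n^{lc}(X)\to H_n^{lc}(Y)\qquad\text{for all } n\ge0.$$
   Context: Given $\epsilon>0$, a map $g:X\to Y$ between metric spaces is $\epsilon$-continuous if there exists $\delta>0$ such that $\sup\{d_Y(g(x_1),g(x_2)) : d_X(x_1,x_2)<\delta\}<\epsilon$. Let $\Delta^n\subset\mathbb{R}^{n+1}$ be the standard $n$-simplex with its Euclidean metric. An $\epsilon$-singular $n$-simplex of $X$ is an $\epsilon$-continuous map $\sigma:\Delta^n\to X$. $C_n^{\epsilon}(X)$ is the free abelian group on all $\epsilon$-singular $n$-simplices, with the usual singular boundary operator $\partial_n\sigma=\sum_{i=0}^n(-1)^i\sigma|[v_0,\dots,\hat v_i,\dots,v_n]$, and $H_n^{\epsilon}(X)=\ker\partial_n/\operatorname{im}\partial_{n+1}$. For $0<\mu\le\epsilon$ the inclusion $C_*^{\mu}(X)\hookrightarrow C_*^{\epsilon}(X)$ is a chain map and induces $\varphi_{\mu\epsilon*}:H_n^{\mu}(X)\to H_n^{\epsilon}(X)$. The $n$-th $lc$-homology group is the inverse limit $H_n^{lc}(X)=\varprojlim_{\epsilon>0}H_n^{\epsilon}(X)$ along these maps, i.e.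 the group of families $(a_\epsilon)_{\epsilon>0}$, $a_\epsilon\in H_n^\epsilon(X)$, with $a_\epsilon=\varphi_{\mu\epsilon*}(a_\mu)$ for all $\mu\le\epsilon$. Induced maps: let $f:X\to Y$ be uniformly continuous. For each $\eta>0$ there is $\epsilon>0$ such that $f\circ\sigma$ is $\eta$-continuous for every $\epsilon$-continuous $\sigma:\Delta^n\to X$; then $\sigma\mapsto f\circ\sigma$ induces $H_n^{\epsilon}(X)\to H_n^{\eta}(Y)$. The map $f_{*}^{lc}:H_n^{lc}(X)\to H_n^{lc}(Y)$ sends $(a_\epsilon)_\epsilon$ to the family whose $\eta$-coordinate is the image of $a_\epsilon$ for any such $\epsilon$. $X\times[0,1]$ carries a standard product metric, e.g. $\max\{d_X(x,x'),|t-t'|\}$. *)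

theory Defs
  imports "HOL-Analysis.Analysis" "HOL-Homology.Homology"
begin

text \<open>
  Singular simplices and chains are represented as in \<^theory>\<open>HOL-Homology.Simplices\<close>: a simplex
  is a function \<^typ>\<open>(nat \<Rightarrow> real) \<Rightarrow> 'a\<close> that is extensional on \<^const>\<open>standard_simplex\<close>, a chain
  is an element of \<^typ>\<open>'a chain\<close>.  The library operators \<^const>\<open>chain_boundary\<close> and
  \<^const>\<open>chain_map\<close> do not refer to a topology, so they apply verbatim to discontinuous simplices.
\<close>

subsection \<open>\<open>\<epsilon>\<close>-continuity and \<open>\<epsilon>\<close>-singular simplices\<close>

definition simplex_metric :: "nat \<Rightarrow> (nat \<Rightarrow> real) metric" where
  "simplex_metric n = metric (standard_simplex n, \<lambda>x y. L2_set (\<lambda>i. x i - y i) {..n})"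

lemma Metric_space_standard_simplex:
  "Metric_space (standard_simplex n) (\<lambda>x y. L2_set (\<lambda>i. x i - y i) {..n})"
proof
  fix x y :: "nat \<Rightarrow> real"
  show "L2_set (\<lambda>i. x i - y i) {..n} = L2_set (\<lambda>i. y i - x i) {..n}"
    by (simp add: L2_set_def power2_commute)
next
  fix x y :: "nat \<Rightarrow> real"
  assume xy: "x \<in> standard_simplex n" "y \<in> standard_simplex n"
  have "x = y" if "\<forall>i\<le>n. x i = y i"
  proof
    fix i
    show "x i = y i"
      using that xy by (cases "i \<le> n") (auto simp: standard_simplex_def)
  qed
  then show "L2_set (\<lambda>i. x i - y i) {..n} = 0 \<longleftrightarrow> x = y"
    by (auto simp: L2_set_eq_0_iff)
next
  fix x y z :: "nat \<Rightarrow> real"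
  show "L2_set (\<lambda>i. x i - z i) {..n} \<le> L2_set (\<lambda>i. x i - y i) {..n} + L2_set (\<lambda>i. y i - z i) {..n}"
    using L2_set_triangle_ineq [of "\<lambda>i. x i - y i" "\<lambda>i. y i - z i" "{..n}"] by simp
qed simp

lemma mspace_simplex_metric [simp]: "mspace (simplex_metric n) = standard_simplex n"
  by (simp add: simplex_metric_def Metric_space.mspace_metric [OF Metric_space_standard_simplex])

lemma mdist_simplex_metric [simp]:
  "mdist (simplex_metric n) x y = L2_set (\<lambda>i. x i - y i) {..n}"
  by (simp add: simplex_metric_def Metric_space.mdist_metric [OF Metric_space_standard_simplex])

text \<open>The supremum is taken in the extended reals: it may be infinite, and it is \<open>-\<infinity>\<close> (so the
  condition holds) when the domain is empty.\<close>

definition eps_continuous_map :: "real \<Rightarrow> 'a metric \<Rightarrow> 'b metric \<Rightarrow> ('a \<Rightarrow> 'b) \<Rightarrow> bool" where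
  "eps_continuous_map \<epsilon> X Y g \<longleftrightarrow>
     g \<in> mspace X \<rightarrow> mspace Y \<and>
     (\<exists>\<delta>>0. Sup {ereal (mdist Y (g x1) (g x2)) | x1 x2.
                   x1 \<in> mspace X \<and> x2 \<in> mspace X \<and> mdist X x1 x2 < \<delta>} < ereal \<epsilon>)"

definition eps_simplex_set :: "nat \<Rightarrow> real \<Rightarrow> 'a metric \<Rightarrow> ((nat \<Rightarrow> real) \<Rightarrow> 'a) set" where
  "eps_simplex_set n \<epsilon> X =
     {\<sigma> \<in> extensional (standard_simplex n). eps_continuous_map \<epsilon> (simplex_metric n) X \<sigma>}"

subsection \<open>The groups \<open>H\<^sub>n\<^sup>\<epsilon>(X)\<close>\<close>

definition eps_chain_group :: "nat \<Rightarrow> real \<Rightarrow> 'a metric \<Rightarrow> 'a chain monoid" where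
  "eps_chain_group n \<epsilon> X = free_Abelian_group (eps_simplex_set n \<epsilon> X)"

text \<open>Since \<^term>\<open>chain_boundary 0\<close> is the zero map, every \<open>0\<close>-chain is a cycle; the codomain index
  \<open>n - 1 = 0\<close> is then immaterial.\<close>

definition eps_cycle_group :: "nat \<Rightarrow> real \<Rightarrow> 'a metric \<Rightarrow> 'a chain monoid" where
  "eps_cycle_group n \<epsilon> X = (eps_chain_group n \<epsilon> X)
     \<lparr>carrier := kernel (eps_chain_group n \<epsilon> X) (eps_chain_group (n - 1) \<epsilon> X) (chain_boundary n)\<rparr>"

definition eps_boundaries :: "nat \<Rightarrow> real \<Rightarrow> 'a metric \<Rightarrow> 'a chain set" where
  "eps_boundaries n \<epsilon> X = chain_boundary (Suc n) ` carrier (eps_chain_group (Suc n) \<epsilon> X)"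

definition eps_homology_group :: "nat \<Rightarrow> real \<Rightarrow> 'a metric \<Rightarrow> 'a chain set monoid" where
  "eps_homology_group n \<epsilon> X = eps_cycle_group n \<epsilon> X Mod eps_boundaries n \<epsilon> X"

definition eps_homology_class :: "nat \<Rightarrow> real \<Rightarrow> 'a metric \<Rightarrow> 'a chain \<Rightarrow> 'a chain set" where
  "eps_homology_class n \<epsilon> X c = eps_boundaries n \<epsilon> X #>\<^bsub>eps_cycle_group n \<epsilon> X\<^esub> c"

text \<open>The map into \<open>H\<^sub>n\<^sup>\<eta>(Y)\<close> induced by a chain-level map \<open>h\<close>: it sends the class of \<open>c\<close> to the class
  of \<open>h c\<close>.  The set whose element is taken is a singleton whenever \<open>h\<close> is compatible with cycles
  and boundaries.\<close>

definition eps_hom_induced ::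
    "nat \<Rightarrow> real \<Rightarrow> 'b metric \<Rightarrow> ('a chain \<Rightarrow> 'b chain) \<Rightarrow> 'a chain set \<Rightarrow> 'b chain set" where
  "eps_hom_induced n \<eta> Y h A = the_elem ((\<lambda>c. eps_homology_class n \<eta> Y (h c)) ` A)"

subsection \<open>\<open>lc\<close>-homology\<close>

text \<open>The inverse limit, as a subgroup of the product over all \<open>\<epsilon> > 0\<close>.  The bonding map
  \<open>H\<^sub>n\<^sup>\<mu>(X) \<rightarrow> H\<^sub>n\<^sup>\<epsilon>(X)\<close> is induced by the inclusion of chain groups.\<close>

definition lc_homology_group :: "nat \<Rightarrow> 'a metric \<Rightarrow> (real \<Rightarrow> 'a chain set) monoid" where
  "lc_homology_group n X = (product_group {0<..} (\<lambda>\<epsilon>. eps_homology_group n \<epsilon> X))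
     \<lparr>carrier := {a \<in> carrier (product_group {0<..} (\<lambda>\<epsilon>. eps_homology_group n \<epsilon> X)).
        \<forall>\<mu> \<epsilon>. 0 < \<mu> \<and> \<mu> \<le> \<epsilon> \<longrightarrow> a \<epsilon> = eps_hom_induced n \<epsilon> X (\<lambda>c. c) (a \<mu>)}\<rparr>"

text \<open>Composition with \<open>f\<close> takes \<open>\<epsilon>\<close>-simplices to \<open>\<eta>\<close>-simplices.  This is required in every dimension:
  to induce a map on \<open>H\<^sub>n\<close> both dimensions \<open>n\<close> and \<open>n + 1\<close> are needed, and on
  the one-point \<open>\<Delta>\<^sup>0\<close> alone the condition would be vacuous.\<close>

definition eps_admissible :: "'a metric \<Rightarrow> 'b metric \<Rightarrow> ('a \<Rightarrow> 'b) \<Rightarrow> real \<Rightarrow> real \<Rightarrow> bool" where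
  "eps_admissible X Y f \<epsilon> \<eta> \<longleftrightarrow>
     0 < \<epsilon> \<and> (\<forall>k. \<forall>\<sigma> \<in> eps_simplex_set k \<epsilon> X. simplex_map k f \<sigma> \<in> eps_simplex_set k \<eta> Y)"

text \<open>The choice of \<open>\<epsilon>\<close> is immaterial, see \<open>lc_hom_induced_apply\<close> below.\<close>

definition lc_hom_induced ::
    "nat \<Rightarrow> 'a metric \<Rightarrow> 'b metric \<Rightarrow> ('a \<Rightarrow> 'b) \<Rightarrow> (real \<Rightarrow> 'a chain set) \<Rightarrow> real \<Rightarrow> 'b chain set" where
  "lc_hom_induced n X Y f = (\<lambda>a \<in> carrier (lc_homology_group n X). \<lambda>\<eta> \<in> {0<..}.
     eps_hom_induced n \<eta> Y (chain_map n f) (a (SOME \<epsilon>. eps_admissible X Y f \<epsilon> \<eta>)))"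

lemma ex_eps_admissible:
  assumes f: "uniformly_continuous_map X Y f" and "0 < \<eta>"
  shows "\<exists>\<epsilon>. eps_admissible X Y f \<epsilon> \<eta>"
proof -
  have fXY: "f \<in> mspace X \<rightarrow> mspace Y"
    using f by (simp add: uniformly_continuous_map_def)
  obtain \<epsilon> where "0 < \<epsilon>" and
    \<epsilon>: "\<And>x y. \<lbrakk>x \<in> mspace X; y \<in> mspace X; mdist X y x < \<epsilon>\<rbrakk> \<Longrightarrow> mdist Y (f y) (f x) < \<eta> / 2"
    using f \<open>0 < \<eta>\<close> unfolding uniformly_continuous_map_def by (meson half_gt_zero)
  have "simplex_map k f \<sigma> \<in> eps_simplex_set k \<eta> Y" if \<sigma>_in: "\<sigma> \<in> eps_simplex_set k \<epsilon> X" for k \<sigma>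
  proof -
    let ?D = "simplex_metric k"
    have \<sigma>: "\<sigma> \<in> standard_simplex k \<rightarrow> mspace X"
      using \<sigma>_in by (auto simp: eps_simplex_set_def eps_continuous_map_def)
    obtain \<delta> where "\<delta> > 0" and \<delta>: "Sup {ereal (mdist X (\<sigma> x1) (\<sigma> x2)) | x1 x2.
        x1 \<in> mspace ?D \<and> x2 \<in> mspace ?D \<and> mdist ?D x1 x2 < \<delta>} < ereal \<epsilon>"
      using \<sigma>_in unfolding eps_simplex_set_def eps_continuous_map_def
      by (elim CollectE conjE exE)
    have *: "mdist Y (f (\<sigma> x1)) (f (\<sigma> x2)) < \<eta> / 2"
      if x: "x1 \<in> mspace ?D" "x2 \<in> mspace ?D" "mdist ?D x1 x2 < \<delta>" for x1 x2
    proof (rule \<epsilon>)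
      have "ereal (mdist X (\<sigma> x1) (\<sigma> x2)) < ereal \<epsilon>"
        by (rule le_less_trans [OF Sup_upper \<delta>]) (use x in blast)
      then show "mdist X (\<sigma> x1) (\<sigma> x2) < \<epsilon>" by simp
    qed (use x \<sigma> in auto)
    have "Sup {ereal (mdist Y (simplex_map k f \<sigma> x1) (simplex_map k f \<sigma> x2)) | x1 x2.
        x1 \<in> mspace ?D \<and> x2 \<in> mspace ?D \<and> mdist ?D x1 x2 < \<delta>} \<le> ereal (\<eta> / 2)"
    proof (rule Sup_least, clarify)
      fix x1 x2
      assume x: "x1 \<in> mspace ?D" "x2 \<in> mspace ?D" "mdist ?D x1 x2 < \<delta>"
      with * [OF x]
      show "ereal (mdist Y (simplex_map k f \<sigma> x1) (simplex_map k f \<sigma> x2)) \<le> ereal (\<eta> / 2)"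
        by (simp add: simplex_map_def)
    qed
    also have "\<dots> < ereal \<eta>"
      using \<open>0 < \<eta>\<close> by simp
    finally have "\<exists>\<delta>>0. Sup {ereal (mdist Y (simplex_map k f \<sigma> x1) (simplex_map k f \<sigma> x2)) | x1 x2.
        x1 \<in> mspace ?D \<and> x2 \<in> mspace ?D \<and> mdist ?D x1 x2 < \<delta>} < ereal \<eta>"
      using \<open>\<delta> > 0\<close> by (intro exI conjI)
    moreover have "simplex_map k f \<sigma> \<in> mspace ?D \<rightarrow> mspace Y"
      using \<sigma> fXY by (auto simp: simplex_map_def)
    moreover have "simplex_map k f \<sigma> \<in> extensional (standard_simplex k)"
      by (simp add: simplex_map_def)
    ultimately show ?thesis
      unfolding eps_simplex_set_def eps_continuous_map_def by (intro CollectI conjI)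
  qed
  with \<open>0 < \<epsilon>\<close> show ?thesis
    by (auto simp: eps_admissible_def)
qed

lemma chain_boundary_chain_map':
  fixes f :: "'b \<Rightarrow> 'a" and c :: "'b chain"
  shows "chain_boundary p (chain_map p f c) = chain_map (p - Suc 0) f (chain_boundary p c)"
proof -
  define T where "T = topology (\<lambda>S :: 'b set. S = {} \<or> S = UNIV)"
  have "istopology (\<lambda>S :: 'b set. S = {} \<or> S = UNIV)"
    unfolding istopology_def by blast
  then have T: "openin T S \<longleftrightarrow> S = {} \<or> S = UNIV" for S
    by (simp add: T_def topology_inverse')
  then have top: "topspace T = UNIV"
    by (metis UNIV_I openin_subset top.extremum_uniqueI)
  have face: "singular_face p k (restrict \<sigma> (standard_simplex p)) = singular_face p k \<sigma>"
    if "p > 0" "k \<le> p" for k and \<sigma> :: "(nat \<Rightarrow> real) \<Rightarrow> 'b"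
    using that simplical_face_in_standard_simplex [of p k]
    by (auto simp: singular_face_def restrict_def fun_eq_iff)
  have one: "chain_boundary p (chain_map p f (frag_of \<sigma>))
      = chain_map (p - Suc 0) f (chain_boundary p (frag_of \<sigma>))" for \<sigma>
  proof -
    let ?r = "restrict \<sigma> (standard_simplex p)"
    have "singular_simplex p T ?r"
      unfolding singular_simplex_def continuous_map_def T top
      using openin_topspace [of "subtopology (powertop_real UNIV) (standard_simplex p)"]
      by auto
    then have "chain_boundary p (chain_map p f (frag_of ?r))
        = chain_map (p - Suc 0) f (chain_boundary p (frag_of ?r))"
      by (intro chain_boundary_chain_map [of p T]) (simp add: singular_chain_of)
    moreover have "chain_map p f (frag_of ?r) = chain_map p f (frag_of \<sigma>)"
      by (auto simp: chain_map_of simplex_map_def intro!: arg_cong [where f = frag_of])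
    moreover have "chain_boundary p (frag_of ?r) = chain_boundary p (frag_of \<sigma>)"
      by (auto simp: chain_boundary_of face)
    ultimately show ?thesis by simp
  qed
  have "Poly_Mapping.keys c \<subseteq> UNIV" by simp
  then show ?thesis
    by (induction c rule: frag_induction) (auto simp: one chain_boundary_diff chain_map_diff simp del: chain_map_of)
qed

lemma carrier_eps_chain_group:
  "carrier (eps_chain_group n \<epsilon> X) = {c. Poly_Mapping.keys c \<subseteq> eps_simplex_set n \<epsilon> X}"
  by (simp add: eps_chain_group_def free_Abelian_group_def)

lemma eps_homology_class_eq: "eps_homology_class n \<epsilon> X c = (\<lambda>b. b + c) ` eps_boundaries n \<epsilon> X"
  by (auto simp: eps_homology_class_def r_coset_def eps_cycle_group_def eps_chain_group_def
      free_Abelian_group_def)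

lemma eps_boundaries_diff:
  assumes "a \<in> eps_boundaries n \<epsilon> X" "b \<in> eps_boundaries n \<epsilon> X"
  shows "a - b \<in> eps_boundaries n \<epsilon> X"
proof -
  obtain a' b' where ab: "a = chain_boundary (Suc n) a'" "b = chain_boundary (Suc n) b'"
    and "a' \<in> carrier (eps_chain_group (Suc n) \<epsilon> X)" "b' \<in> carrier (eps_chain_group (Suc n) \<epsilon> X)"
    using assms by (auto simp: eps_boundaries_def)
  then have "a' - b' \<in> carrier (eps_chain_group (Suc n) \<epsilon> X)"
    using keys_diff [of a' b'] by (auto simp: carrier_eps_chain_group)
  then show ?thesis
    by (auto simp: eps_boundaries_def ab simp flip: chain_boundary_diff)
qed

lemma zero_in_eps_boundaries: "0 \<in> eps_boundaries n \<epsilon> X"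
  unfolding eps_boundaries_def carrier_eps_chain_group
  by (rule image_eqI [where x = 0]) auto

lemma eps_homology_class_cong:
  assumes "c - d \<in> eps_boundaries n \<epsilon> X"
  shows "eps_homology_class n \<epsilon> X c = eps_homology_class n \<epsilon> X d"
proof -
  have *: "eps_homology_class n \<epsilon> X u \<subseteq> eps_homology_class n \<epsilon> X v"
    if "v - u \<in> eps_boundaries n \<epsilon> X" for u v
  proof
    fix w
    assume "w \<in> eps_homology_class n \<epsilon> X u"
    then obtain b where b: "b \<in> eps_boundaries n \<epsilon> X" "w = b + u"
      by (auto simp: eps_homology_class_eq)
    then have "b - (v - u) \<in> eps_boundaries n \<epsilon> X" "w = (b - (v - u)) + v"
      using eps_boundaries_diff that by auto
    then show "w \<in> eps_homology_class n \<epsilon> X v"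
      unfolding eps_homology_class_eq by (rule image_eqI [rotated])
  qed
  have "d - c \<in> eps_boundaries n \<epsilon> X"
    using eps_boundaries_diff [OF zero_in_eps_boundaries assms] by simp
  with assms * show ?thesis by blast
qed

lemma eps_hom_induced_class:
  assumes add: "\<And>b c. h (b + c) = h b + h c"
    and bd: "\<And>b. b \<in> eps_boundaries n \<epsilon> X \<Longrightarrow> h b \<in> eps_boundaries n \<eta> Y"
  shows "eps_hom_induced n \<eta> Y h (eps_homology_class n \<epsilon> X c) = eps_homology_class n \<eta> Y (h c)"
proof -
  have "eps_homology_class n \<eta> Y (h (b + c)) = eps_homology_class n \<eta> Y (h c)"
    if "b \<in> eps_boundaries n \<epsilon> X" for b
    using bd [OF that] by (intro eps_homology_class_cong) (simp add: add)
  then have "(\<lambda>c. eps_homology_class n \<eta> Y (h c)) ` eps_homology_class n \<epsilon> X c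
      = {eps_homology_class n \<eta> Y (h c)}"
    using zero_in_eps_boundaries [of n \<epsilon> X] by (auto simp: eps_homology_class_eq image_image)
  then show ?thesis
    by (simp add: eps_hom_induced_def)
qed

lemma eps_hom_induced_chain_map:
  assumes "eps_admissible X Y f \<epsilon> \<eta>"
  shows "eps_hom_induced n \<eta> Y (chain_map n f) (eps_homology_class n \<epsilon> X c)
    = eps_homology_class n \<eta> Y (chain_map n f c)"
proof (rule eps_hom_induced_class)
  fix b
  assume "b \<in> eps_boundaries n \<epsilon> X"
  then obtain d where d: "b = chain_boundary (Suc n) d"
    "Poly_Mapping.keys d \<subseteq> eps_simplex_set (Suc n) \<epsilon> X"
    by (auto simp: eps_boundaries_def carrier_eps_chain_group)
  have "Poly_Mapping.keys (chain_map (Suc n) f d) \<subseteq> eps_simplex_set (Suc n) \<eta> Y"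
  proof -
    have "Poly_Mapping.keys (chain_map (Suc n) f d)
        \<subseteq> (\<Union>\<sigma> \<in> Poly_Mapping.keys d. Poly_Mapping.keys (frag_of (simplex_map (Suc n) f \<sigma>)))"
      using keys_frag_extend [of "frag_of \<circ> simplex_map (Suc n) f" d] by (simp add: chain_map_def)
    also have "\<dots> \<subseteq> eps_simplex_set (Suc n) \<eta> Y"
      using d(2) assms by (auto simp: eps_admissible_def)
    finally show ?thesis .
  qed
  then show "chain_map n f b \<in> eps_boundaries n \<eta> Y"
    unfolding eps_boundaries_def carrier_eps_chain_group d(1)
    by (intro image_eqI [OF _ CollectI]) (simp_all only: chain_boundary_chain_map' diff_Suc_1')
qed (simp add: chain_map_add)

lemma eps_hom_induced_inclusion:
  assumes "\<mu> \<le> \<epsilon>"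
  shows "eps_hom_induced n \<epsilon> X (\<lambda>c. c) (eps_homology_class n \<mu> X c) = eps_homology_class n \<epsilon> X c"
proof (rule eps_hom_induced_class)
  have "eps_simplex_set k \<mu> X \<subseteq> eps_simplex_set k \<epsilon> X" for k
  proof -
    have "eps_continuous_map \<epsilon> D X \<sigma>" if \<sigma>: "eps_continuous_map \<mu> D X \<sigma>"
      for \<sigma> and D :: "(nat \<Rightarrow> real) metric"
    proof -
      obtain \<delta> where \<delta>: "0 < \<delta>" "Sup {ereal (mdist X (\<sigma> x1) (\<sigma> x2)) | x1 x2.
          x1 \<in> mspace D \<and> x2 \<in> mspace D \<and> mdist D x1 x2 < \<delta>} < ereal \<mu>"
        using \<sigma> unfolding eps_continuous_map_def by (elim conjE exE)
      have "ereal \<mu> \<le> ereal \<epsilon>"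
        using assms by simp
      with \<delta> \<sigma> show ?thesis
        unfolding eps_continuous_map_def by (intro conjI exI [of _ \<delta>]) (simp, simp, order)
    qed
    then show ?thesis
      by (auto simp: eps_simplex_set_def)
  qed
  then show "b \<in> eps_boundaries n \<epsilon> X" if "b \<in> eps_boundaries n \<mu> X" for b
    using that unfolding eps_boundaries_def carrier_eps_chain_group by blast
qed simp

lemma lc_hom_induced_apply:
  assumes a: "a \<in> carrier (lc_homology_group n X)"
    and "0 < \<eta>" and adm: "eps_admissible X Y f \<epsilon> \<eta>"
  shows "lc_hom_induced n X Y f a \<eta> = eps_hom_induced n \<eta> Y (chain_map n f) (a \<epsilon>)"
proof -
  define \<epsilon>' where "\<epsilon>' = (SOME \<epsilon>. eps_admissible X Y f \<epsilon> \<eta>)"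
  have adm': "eps_admissible X Y f \<epsilon>' \<eta>"
    unfolding \<epsilon>'_def using adm by (rule someI)
  define m where "m = min \<epsilon> \<epsilon>'"
  have "0 < m"
    using adm adm' by (simp add: m_def eps_admissible_def)
  have "a m \<in> carrier (eps_homology_group n m X)"
    using a \<open>0 < m\<close> by (auto simp: lc_homology_group_def)
  then obtain c where c: "a m = eps_homology_class n m X c"
    by (auto simp: eps_homology_group_def FactGroup_def RCOSETS_def eps_homology_class_def)
  have val: "a e = eps_homology_class n e X c" if "m \<le> e" for e
  proof -
    have "a e = eps_hom_induced n e X (\<lambda>c. c) (a m)"
      using a \<open>0 < m\<close> that by (simp add: lc_homology_group_def)
    then show ?thesis
      using eps_hom_induced_inclusion [OF that] by (simp add: c)
  qed
  have "lc_hom_induced n X Y f a \<eta> = eps_hom_induced n \<eta> Y (chain_map n f) (a \<epsilon>')"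
    using a \<open>0 < \<eta>\<close> by (simp add: lc_hom_induced_def \<epsilon>'_def)
  also have "\<dots> = eps_homology_class n \<eta> Y (chain_map n f c)"
    using val [of \<epsilon>'] eps_hom_induced_chain_map [OF adm'] by (simp add: m_def)
  also have "\<dots> = eps_hom_induced n \<eta> Y (chain_map n f) (a \<epsilon>)"
    using val [of \<epsilon>] eps_hom_induced_chain_map [OF adm] by (simp add: m_def)
  finally show ?thesis .
qed

subsection \<open>Uniform homotopy\<close>

text \<open>\<^const>\<open>prod_metric\<close> is the Euclidean product metric, which is bi-Lipschitz equivalent to the
  maximum metric and hence yields the same uniformly continuous maps.\<close>

definition uniformly_homotopic :: "'a metric \<Rightarrow> 'b metric \<Rightarrow> ('a \<Rightarrow> 'b) \<Rightarrow> ('a \<Rightarrow> 'b) \<Rightarrow> bool" where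
  "uniformly_homotopic X Y f g \<longleftrightarrow>
     (\<exists>h :: real \<Rightarrow> 'a \<Rightarrow> 'b.
        (\<forall>t \<in> {0..1}. uniformly_continuous_map X Y (h t)) \<and>
        (\<forall>x \<in> mspace X. h 0 x = f x) \<and>
        (\<forall>x \<in> mspace X. h 1 x = g x) \<and>
        uniformly_continuous_map (prod_metric X (submetric euclidean_metric {0..1})) Y
          (\<lambda>(x, t). h t x))"

end

theory Submission
  imports Defs
begin

text \<open>
  A cycle \<open>c\<close> of \<open>\<epsilon>\<close>-simplices sweeps out a chain of dimension one higher in \<open>X \<times> [0,1]\<close>
  whose boundary is the copy of \<open>c\<close> at time \<open>1\<close> minus the copy at time \<open>0\<close>.  The homotopy \<open>F\<close> sends
  this chain to \<open>Y\<close>, where it shows that the images of \<open>c\<close> under \<open>g\<close> and \<open>f\<close> are homologous.  The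
  classical argument applies because neither step needs the simplices of \<open>c\<close> to be continuous, only
  a bound on their oscillation.

  The swept chain comes from acyclic models instead of an explicit triangulation of the prism.  It
  suffices to have, in each dimension, one chain \<open>p\<close> on \<open>\<Delta>\<^sup>n \<times> [0,1]\<close> whose boundary is the
  top minus the bottom minus copies, over the faces of \<open>\<Delta>\<^sup>n\<close>, of a chain \<open>q\<close> on
  \<open>\<Delta>\<^sup>n\<^sup>-\<^sup>1 \<times> [0,1]\<close>; pushing \<open>p\<close> forward along \<open>\<sigma> \<times> id\<close> then
  handles all simplices \<open>\<sigma>\<close>, continuous or not (\<open>chain_boundary_cylinder_extend\<close>).  Such \<open>p\<close>
  exist by induction on \<open>n\<close>: the prescribed boundary is a cycle, and \<open>\<Delta>\<^sup>n \<times> [0,1]\<close> is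
  contractible (\<open>ex_prism_chain\<close>).

  For the metric control, the simplices of \<open>p\<close> are genuinely continuous on a compact space, hence
  uniformly continuous.  Composing one of them with \<open>\<sigma> \<times> id\<close> for an \<open>\<epsilon>\<close>-continuous \<open>\<sigma>\<close>
  gives a \<open>2\<epsilon>\<close>-continuous map into \<open>X \<times> [0,1]\<close> (\<open>eps_continuous_map_cylinder\<close>), and
  uniform continuity of \<open>F\<close> makes the image \<open>\<eta>\<close>-continuous once \<open>\<epsilon>\<close> is small.  So for every
  \<open>\<eta>\<close> the two families in the inverse limit have equal \<open>\<eta>\<close>-coordinates.
\<close>

section \<open>Pushing chains on a cylinder forward along simplices\<close>

definition cylinder :: "nat \<Rightarrow> ((nat \<Rightarrow> real) \<times> real) topology" where
  "cylinder n = prod_topology (subtopology (powertop_real UNIV) (standard_simplex n)) (top_of_set {0..1})"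

abbreviation identity_simplex :: "nat \<Rightarrow> (nat \<Rightarrow> real) chain" where
  "identity_simplex n \<equiv> frag_of (restrict id (standard_simplex n))"

text \<open>
  The linear extension of \<open>\<sigma> \<mapsto> (\<sigma> \<times> id)\<^sub># p\<close>.  With \<open>p\<close> a fundamental chain of
  \<open>\<Delta>\<^sup>n \<times> [0,1]\<close> this is the cross product of a chain with the unit interval.  The number \<open>m\<close> is the
  dimension of \<open>p\<close>, not that of \<open>c\<close>.
\<close>

definition cylinder_extend ::
    "nat \<Rightarrow> ((nat \<Rightarrow> real) \<times> real) chain \<Rightarrow> 'a chain \<Rightarrow> ('a \<times> real) chain" where
  "cylinder_extend m p c = frag_extend (\<lambda>\<sigma>. chain_map m (map_prod \<sigma> id) p) c"

lemma cylinder_extend_0 [simp]: "cylinder_extend m p 0 = 0"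
  by (simp add: cylinder_extend_def)

lemma cylinder_extend_of [simp]:
  "cylinder_extend m p (frag_of \<sigma>) = chain_map m (map_prod \<sigma> id) p"
  by (simp add: cylinder_extend_def)

lemma cylinder_extend_diff:
  "cylinder_extend m p (a - b) = cylinder_extend m p a - cylinder_extend m p b"
  by (simp add: cylinder_extend_def frag_extend_diff)

lemma topspace_cylinder: "topspace (cylinder n) = standard_simplex n \<times> {0..1}"
  by (simp add: cylinder_def)

text \<open>
  Both sides push \<open>p\<close> forward along \<open>(f \<circ> \<tau>) \<times> id\<close>.  The simplex \<^term>\<open>simplex_map k f \<tau>\<close>
  agrees with \<open>f \<circ> \<tau>\<close> only on the standard simplex, so it matters that \<open>p\<close> lives on the cylinder.
\<close>

lemma cylinder_extend_natural:
  assumes p: "singular_chain m (cylinder k) p"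
  shows "chain_map m (map_prod f id) (cylinder_extend m p d) = cylinder_extend m p (chain_map k f d)"
  using subset_UNIV
proof (induction d rule: frag_induction)
  case (one \<tau>)
  have "chain_map m (map_prod f id) (chain_map m (map_prod \<tau> id) p)
      = chain_map m (map_prod f id \<circ> map_prod \<tau> id) p"
    by (simp add: chain_map_compose)
  also have "\<dots> = chain_map m (map_prod (simplex_map k f \<tau>) id) p"
    by (rule chain_map_eq [OF p]) (auto simp: topspace_cylinder simplex_map_def)
  finally show ?case by (simp only: cylinder_extend_of chain_map_of)
qed (simp_all add: cylinder_extend_diff chain_map_diff)

lemma singular_chain_cylinder_extend:
  assumes p: "singular_chain m (cylinder k) p"
    and d: "singular_chain k (subtopology (powertop_real UNIV) (standard_simplex n)) d"
  shows "singular_chain m (cylinder n) (cylinder_extend m p d)"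
  unfolding cylinder_extend_def
proof (rule singular_chain_extend)
  fix \<tau>
  assume "\<tau> \<in> Poly_Mapping.keys d"
  with d have "singular_simplex k (subtopology (powertop_real UNIV) (standard_simplex n)) \<tau>"
    by (auto simp: singular_chain_def)
  then have "continuous_map (cylinder k) (cylinder n) (map_prod \<tau> id)"
    unfolding cylinder_def map_prod_def singular_simplex_def
    by (subst continuous_map_prod_top) auto
  with p show "singular_chain m (cylinder n) (chain_map m (map_prod \<tau> id) p)"
    by (rule singular_chain_chain_map)
qed

text \<open>
  The boundary formula that a fundamental chain \<open>p\<close> of \<open>\<Delta>\<^sup>n \<times> [0,1]\<close> has to satisfy, where \<open>q\<close>
  is the corresponding chain one dimension below; it is spread over the faces of \<open>\<Delta>\<^sup>n\<close> by
  \<^const>\<open>cylinder_extend\<close>.  For \<open>n = 0\<close> the side term vanishes, because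
  \<^term>\<open>chain_boundary 0\<close> is zero.
\<close>

definition prism_relation ::
    "nat \<Rightarrow> ((nat \<Rightarrow> real) \<times> real) chain \<Rightarrow> ((nat \<Rightarrow> real) \<times> real) chain \<Rightarrow> bool" where
  "prism_relation n p q \<longleftrightarrow> chain_boundary (Suc n) p =
     chain_map n (\<lambda>x. (x, 1)) (identity_simplex n) - chain_map n (\<lambda>x. (x, 0)) (identity_simplex n)
     - cylinder_extend n q (chain_boundary n (identity_simplex n))"

text \<open>
  The boundary formula for the single chain \<open>p\<close> yields the chain homotopy formula for all chains, by
  naturality: a simplex \<open>\<sigma>\<close> is the image of the identity simplex under \<open>\<sigma>\<close>, and \<open>(\<sigma> \<times> id)\<^sub>#\<close>
  commutes with the boundary operator without any continuity of \<open>\<sigma>\<close>.  Chains are required to be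
  extensional so that the identity simplex is carried to \<open>\<sigma>\<close> itself.
\<close>

lemma chain_boundary_cylinder_extend:
  assumes q: "singular_chain n (cylinder (n - 1)) q" and pq: "prism_relation n p q"
    and c: "Poly_Mapping.keys c \<subseteq> extensional (standard_simplex n)"
  shows "chain_boundary (Suc n) (cylinder_extend (Suc n) p c) =
    chain_map n (\<lambda>x. (x, 1)) c - chain_map n (\<lambda>x. (x, 0)) c - cylinder_extend n q (chain_boundary n c)"
  using c
proof (induction c rule: frag_induction)
  case (one \<sigma>)
  have \<iota>: "chain_map n \<sigma> (identity_simplex n) = frag_of \<sigma>"
    using one by (auto simp: simplex_map_def extensional_def fun_eq_iff intro!: arg_cong [where f = frag_of])
  have slice: "chain_map n (map_prod \<sigma> id) (chain_map n (\<lambda>x. (x, t)) (identity_simplex n))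
      = chain_map n (\<lambda>x. (x, t)) (frag_of \<sigma>)" for t :: real
  proof -
    have "map_prod \<sigma> id \<circ> (\<lambda>x. (x, t)) = (\<lambda>x. (x, t)) \<circ> \<sigma>"
      by auto
    then have "chain_map n (map_prod \<sigma> id) (chain_map n (\<lambda>x. (x, t)) (identity_simplex n))
        = chain_map n (\<lambda>x. (x, t)) (chain_map n \<sigma> (identity_simplex n))"
      by (metis chain_map_compose comp_apply)
    then show ?thesis by (simp only: \<iota>)
  qed
  have "chain_map n (map_prod \<sigma> id) (cylinder_extend n q (chain_boundary n (identity_simplex n)))
      = cylinder_extend n q (chain_map (n - 1) \<sigma> (chain_boundary n (identity_simplex n)))"
    by (rule cylinder_extend_natural [OF q])
  also have "chain_map (n - 1) \<sigma> (chain_boundary n (identity_simplex n)) = chain_boundary n (frag_of \<sigma>)"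
    using chain_boundary_chain_map' [of n \<sigma> "identity_simplex n"] by (simp only: \<iota> One_nat_def)
  finally have side: "chain_map n (map_prod \<sigma> id) (cylinder_extend n q (chain_boundary n (identity_simplex n)))
      = cylinder_extend n q (chain_boundary n (frag_of \<sigma>))" .
  have "chain_boundary (Suc n) (cylinder_extend (Suc n) p (frag_of \<sigma>))
      = chain_map n (map_prod \<sigma> id) (chain_boundary (Suc n) p)"
    by (simp add: chain_boundary_chain_map')
  then show ?case
    using pq by (simp only: prism_relation_def chain_map_diff slice side)
qed (simp_all add: cylinder_extend_diff chain_map_diff chain_boundary_diff)

section \<open>Fundamental chains of prisms\<close>

text \<open>The straight-line homotopy to the vertex \<open>e\<close> stays in the simplex by convexity.\<close>

lemma contractible_standard_simplex:
  "contractible_space (subtopology (powertop_real UNIV) (standard_simplex n))"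
proof -
  let ?T = "subtopology (powertop_real UNIV) (standard_simplex n)"
  define e :: "nat \<Rightarrow> real" where "e = (\<lambda>j. if j = 0 then 1 else 0)"
  define h where "h = (\<lambda>(u::real, x) i. (1 - u) * x i + u * e i)"
  have e: "e \<in> standard_simplex n"
    by (simp add: e_def)
  have 1: "continuous_map (prod_topology (top_of_set {0..1}) ?T) euclideanreal (\<lambda>z. fst z)"
    using continuous_map_fst continuous_map_into_fulltopology by blast
  have 2: "continuous_map (prod_topology (top_of_set {0..1::real}) ?T) euclideanreal (\<lambda>z. snd z i)" for i
    using continuous_map_compose [OF continuous_map_snd [of "top_of_set {0..1::real}" ?T]
        continuous_map_from_subtopology [OF continuous_map_product_projection [of i UNIV "\<lambda>_. euclideanreal"]]]
    by (simp add: o_def)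
  have "continuous_map (prod_topology (top_of_set {0..1}) ?T) (powertop_real UNIV) h"
    unfolding continuous_map_componentwise_UNIV h_def case_prod_unfold
    by (intro allI continuous_intros 1 2)
  moreover have "h \<in> {0..1} \<times> standard_simplex n \<rightarrow> standard_simplex n"
    using convex_standard_simplex e by (auto simp: h_def)
  ultimately have "continuous_map (prod_topology (top_of_set {0..1}) ?T) ?T h"
    by (auto simp: continuous_map_in_subtopology)
  then have "homotopic_with (\<lambda>x. True) ?T ?T id (\<lambda>x. e)"
    unfolding homotopic_with_def by (intro exI [of _ h]) (auto simp: h_def)
  then show ?thesis
    unfolding contractible_space_def by blast
qed

lemma contractible_cylinder: "contractible_space (cylinder n)"
  by (simp add: cylinder_def contractible_space_prod_topology contractible_standard_simplex convex_imp_contractible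
      is_interval_cc)

text \<open>
  The identity is homotopic to a constant map, so a cycle is homologous to a cycle in a one-point
  space, where all cycles of positive dimension bound.
\<close>

lemma cycle_in_contractible_space_is_boundary:
  assumes X: "contractible_space X" and "1 \<le> p" and c: "singular_relcycle p X {} c"
  shows "singular_relboundary p X {} c"
proof -
  obtain a where a: "homotopic_with (\<lambda>x. True) X X id (\<lambda>x. a)"
    using X by (auto simp: contractible_space_def)
  show ?thesis
  proof (cases "a \<in> topspace X")
    case False
    then have "topspace X = {}"
      using homotopic_with_imp_continuous_maps [OF a] by (auto simp: continuous_map_def)
    then have "c = 0"
      using c singular_chain_empty by (auto simp: singular_cycle)
    then show ?thesis by simp
  next
    case True
    have "continuous_map X (subtopology X {a}) (\<lambda>x. a)"
      using True by (simp add: continuous_map_in_subtopology)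
    then have "singular_relcycle p (subtopology X {a}) {} (chain_map p (\<lambda>x. a) c)"
      using c by (intro singular_relcycle_chain_map) auto
    then have "singular_relboundary p (subtopology X {a}) {} (chain_map p (\<lambda>x. a) c)"
      using singular_boundary_eq_cycle_singleton [of "subtopology X {a}" a p] True \<open>1 \<le> p\<close> by simp
    then have "singular_relboundary p X {} (chain_map p (\<lambda>x. a) c)"
      using singular_boundary_mono [of "{a}" "topspace X" p X] True by simp
    moreover have "homologous_rel p X {} (chain_map p id c) (chain_map p (\<lambda>x. a) c)"
      by (rule homotopic_imp_homologous_rel_chain_maps [OF _ c]) (use a in simp)
    moreover have "chain_map p id c = c"
      using c by (auto simp: singular_cycle intro: chain_map_ident)
    ultimately show ?thesis
      unfolding homologous_rel_def by (metis diff_add_cancel singular_relboundary_add)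
  qed
qed

lemma singular_chain_identity_simplex:
  "singular_chain n (subtopology (powertop_real UNIV) (standard_simplex n)) (identity_simplex n)"
  by (simp add: singular_chain_of singular_simplex_def continuous_map_eq [OF continuous_map_id])

lemma continuous_map_slice:
  assumes "t \<in> {0..1}"
  shows "continuous_map (subtopology (powertop_real UNIV) (standard_simplex n)) (cylinder n) (\<lambda>x. (x, t))"
  using assms by (simp add: cylinder_def continuous_map_pairwise o_def)

text \<open>
  The acyclic model argument.  Carrying \<open>q\<close> along in the induction hypothesis is what allows the
  step: the boundary formula for \<open>p\<close> shows that the boundary prescribed in the next dimension is a cycle.
\<close>

lemma ex_prism_chain:
  "\<exists>p q. singular_chain (Suc n) (cylinder n) p \<and> singular_chain n (cylinder (n - 1)) q \<and> prism_relation n p q"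
proof (induction n)
  case 0
  let ?T = "subtopology (powertop_real UNIV) (standard_simplex 0)"
  \<comment> \<open>In dimension 0 not every cycle bounds, but the two ends of the cylinder are homotopic inclusions.\<close>
  have "homologous_rel 0 (cylinder 0) {} (chain_map 0 (\<lambda>x. (x, 1)) (identity_simplex 0))
      (chain_map 0 (\<lambda>x. (x, 0)) (identity_simplex 0))"
  proof (rule homotopic_imp_homologous_rel_chain_maps [where S = ?T and T = "{}"])
    show "homotopic_with (\<lambda>h. h \<in> {} \<rightarrow> {}) ?T (cylinder 0) (\<lambda>x. (x, 1)) (\<lambda>x. (x, 0))"
      using homotopic_into_contractible_space [of ?T "cylinder 0"] continuous_map_slice contractible_cylinder
      by simp
    show "singular_relcycle 0 ?T {} (identity_simplex 0)"
      by (simp only: singular_cycle singular_chain_identity_simplex) (simp add: chain_boundary_def)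
  qed
  then obtain p where "singular_chain (Suc 0) (cylinder 0) p"
    "chain_boundary (Suc 0) p = chain_map 0 (\<lambda>x. (x, 1)) (identity_simplex 0)
      - chain_map 0 (\<lambda>x. (x, 0)) (identity_simplex 0)"
    unfolding homologous_rel_def singular_boundary by blast
  then show ?case
    by (intro exI [of _ p] exI [of _ 0]) (simp add: prism_relation_def chain_boundary_def)
next
  case (Suc n)
  then obtain p q where p: "singular_chain (Suc n) (cylinder n) p"
    and q: "singular_chain n (cylinder (n - 1)) q" and pq: "prism_relation n p q"
    by blast
  let ?T = "subtopology (powertop_real UNIV) (standard_simplex (Suc n))"
  let ?\<iota> = "identity_simplex (Suc n)"
  let ?slice = "\<lambda>t::real. chain_map (Suc n) (\<lambda>x. (x, t)) ?\<iota>"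
  define z where "z = ?slice 1 - ?slice 0 - cylinder_extend (Suc n) p (chain_boundary (Suc n) ?\<iota>)"
  have b\<iota>: "singular_chain n ?T (chain_boundary (Suc n) ?\<iota>)"
    by (rule singular_chain_boundary_alt [OF singular_chain_identity_simplex])
  have "singular_chain (Suc n) (cylinder (Suc n)) (?slice t)" if "t \<in> {0..1}" for t
    by (rule singular_chain_chain_map [OF singular_chain_identity_simplex continuous_map_slice [OF that]])
  then have "singular_chain (Suc n) (cylinder (Suc n)) z"
    unfolding z_def by (intro singular_chain_diff singular_chain_cylinder_extend [OF p b\<iota>]) auto
  \<comment> \<open>The formula for \<open>p\<close> applied to the cycle \<open>\<partial>\<iota>\<close> gives the boundaries of top and bottom, which cancel.\<close>
  moreover have "chain_boundary (Suc n) z = 0"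
  proof -
    have "Poly_Mapping.keys (chain_boundary (Suc n) ?\<iota>) \<subseteq> extensional (standard_simplex n)"
      using b\<iota> by (auto simp: singular_chain_def singular_simplex_def)
    moreover have "chain_boundary n (chain_boundary (Suc n) ?\<iota>) = 0"
      by (rule chain_boundary_boundary_alt [OF singular_chain_identity_simplex])
    ultimately have "chain_boundary (Suc n) (cylinder_extend (Suc n) p (chain_boundary (Suc n) ?\<iota>))
        = chain_map n (\<lambda>x. (x, 1)) (chain_boundary (Suc n) ?\<iota>)
          - chain_map n (\<lambda>x. (x, 0)) (chain_boundary (Suc n) ?\<iota>)"
      using chain_boundary_cylinder_extend [OF q pq, of "chain_boundary (Suc n) ?\<iota>"]
      by (simp only: cylinder_extend_0 diff_zero)
    then show ?thesis
      by (simp add: z_def chain_boundary_diff chain_boundary_chain_map' del: chain_map_of)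
  qed
  ultimately have "singular_relboundary (Suc n) (cylinder (Suc n)) {} z"
    by (intro cycle_in_contractible_space_is_boundary contractible_cylinder) (simp_all add: singular_cycle)
  then obtain r where "singular_chain (Suc (Suc n)) (cylinder (Suc n)) r"
    "chain_boundary (Suc (Suc n)) r = z"
    by (auto simp: singular_boundary)
  then show ?case
    using p by (intro exI [of _ r] exI [of _ p]) (simp add: prism_relation_def z_def)
qed

section \<open>Oscillation of swept simplices\<close>

text \<open>
  The number \<open>e\<close> strictly below \<open>\<epsilon>\<close> expresses that the supremum is less than \<open>\<epsilon>\<close> and not just
  that all distances are.
\<close>

lemma eps_continuous_map_iff:
  "eps_continuous_map \<epsilon> X Y g \<longleftrightarrow> g \<in> mspace X \<rightarrow> mspace Y \<and>
     (\<exists>\<delta>>0. \<exists>e<\<epsilon>. \<forall>x\<in>mspace X. \<forall>y\<in>mspace X. mdist X x y < \<delta> \<longrightarrow> mdist Y (g x) (g y) \<le> e)"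
proof -
  have "Sup A < ereal \<epsilon> \<longleftrightarrow> (\<exists>e<\<epsilon>. \<forall>a\<in>A. a \<le> ereal e)" for A
  proof
    assume "Sup A < ereal \<epsilon>"
    then obtain e where "Sup A < ereal e" "ereal e < ereal \<epsilon>"
      using ereal_dense2 by blast
    then show "\<exists>e<\<epsilon>. \<forall>a\<in>A. a \<le> ereal e"
      by (intro exI [of _ e]) (auto intro: less_imp_le le_less_trans [OF Sup_upper])
  next
    assume "\<exists>e<\<epsilon>. \<forall>a\<in>A. a \<le> ereal e"
    then obtain e where "e < \<epsilon>" "\<And>a. a \<in> A \<Longrightarrow> a \<le> ereal e" by blast
    then show "Sup A < ereal \<epsilon>"
      using Sup_least [of A "ereal e"] by (meson ereal_less_le less_ereal.simps(1) order_le_less_trans)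
  qed
  moreover have "(\<forall>a\<in>{ereal (mdist Y (g x) (g y)) | x y. x \<in> mspace X \<and> y \<in> mspace X \<and> mdist X x y < \<delta>}.
        a \<le> ereal e)
      \<longleftrightarrow> (\<forall>x\<in>mspace X. \<forall>y\<in>mspace X. mdist X x y < \<delta> \<longrightarrow> mdist Y (g x) (g y) \<le> e)" for \<delta> e
    by fastforce
  ultimately show ?thesis
    by (simp only: eps_continuous_map_def)
qed

lemma eps_simplex_set_mono: "\<mu> \<le> \<epsilon> \<Longrightarrow> eps_simplex_set k \<mu> X \<subseteq> eps_simplex_set k \<epsilon> X"
  unfolding eps_simplex_set_def eps_continuous_map_iff by (blast intro: less_le_trans)

lemma eps_admissible_mono:
  assumes "eps_admissible X Y f \<epsilon> \<eta>" "0 < \<mu>" "\<mu> \<le> \<epsilon>"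
  shows "eps_admissible X Y f \<mu> \<eta>"
  using assms eps_simplex_set_mono [of \<mu> \<epsilon> _ X] by (auto simp: eps_admissible_def)

text \<open>
  Coordinates are 1-Lipschitz for the Euclidean metric, and conversely the Euclidean distance is
  bounded by the sum of the finitely many coordinate distances, which is continuous for the product
  topology.  Hence simplices that are continuous for the product topology are so for the metric.
\<close>

lemma mtopology_of_simplex_metric:
  "mtopology_of (simplex_metric n) = subtopology (powertop_real UNIV) (standard_simplex n)"
    (is "?M = ?P")
proof -
  have "continuous_map ?M euclideanreal (\<lambda>x. x i)" for i
  proof (rule Lipschitz_continuous_imp_continuous_map [where ?m2.0 = euclidean_metric, unfolded mtopology_of_euclidean])
    have "dist (x i) (y i) \<le> 1 * L2_set (\<lambda>i. x i - y i) {..n}"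
      if "x \<in> standard_simplex n" "y \<in> standard_simplex n" for x y
    proof (cases "i \<le> n")
      case True
      then show ?thesis
        using member_le_L2_set [of "{..n}" i "\<lambda>i. \<bar>x i - y i\<bar>"] by (simp add: dist_real_def L2_set_def)
    qed (use that in \<open>simp add: standard_simplex_def\<close>)
    then show "Lipschitz_continuous_map (simplex_metric n) euclidean_metric (\<lambda>x. x i)"
      unfolding Lipschitz_continuous_map_def by (intro conjI exI [of _ 1]) auto
  qed
  then have "continuous_map ?M (powertop_real UNIV) (\<lambda>x. x)"
    by (simp add: continuous_map_componentwise_UNIV)
  then have MP: "continuous_map ?M ?P (\<lambda>x. x)"
    by (simp add: continuous_map_in_subtopology)
  have "continuous_map ?P ?M (\<lambda>x. x)"
    unfolding mtopology_of_def Metric_space.continuous_map_to_metric [OF Metric_space_mspace_mdist]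
  proof clarify
    fix x and \<epsilon> :: real
    assume x: "x \<in> topspace ?P" and "0 < \<epsilon>"
    let ?U = "{y \<in> topspace ?P. (\<Sum>i\<le>n. \<bar>x i - y i\<bar>) \<in> {..<\<epsilon>}}"
    have "continuous_map ?P euclideanreal (\<lambda>y. \<Sum>i\<le>n. \<bar>x i - y i\<bar>)"
      by (intro continuous_intros continuous_map_from_subtopology [OF continuous_map_product_projection]) auto
    then have "openin ?P ?U"
      by (rule openin_continuous_map_preimage) simp
    moreover have "y \<in> Metric_space.mball (mspace (simplex_metric n)) (mdist (simplex_metric n)) x \<epsilon>"
      if "y \<in> ?U" for y
      using that x L2_set_le_sum_abs [of "\<lambda>i. x i - y i" "{..n}"]
      unfolding Metric_space.in_mball [OF Metric_space_mspace_mdist] by auto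
    ultimately show "\<exists>U. openin ?P U \<and> x \<in> U \<and>
        (\<forall>y\<in>U. y \<in> Metric_space.mball (mspace (simplex_metric n)) (mdist (simplex_metric n)) x \<epsilon>)"
      using x \<open>0 < \<epsilon>\<close> by (intro exI [of _ ?U]) auto
  qed
  with MP have "homeomorphic_maps ?M ?P (\<lambda>x. x) (\<lambda>x. x)"
    by (simp add: homeomorphic_maps_def)
  then show ?thesis
    using homeomorphic_maps_id [of ?M ?P] by (simp add: id_def)
qed

abbreviation cylinder_metric :: "'a metric \<Rightarrow> ('a \<times> real) metric" where
  "cylinder_metric X \<equiv> prod_metric X (submetric euclidean_metric {0..1})"

text \<open>The Heine-Cantor theorem on the compact standard simplex.\<close>

lemma singular_simplex_cylinder_uniformly_continuous:
  assumes "singular_simplex k (cylinder n) s"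
  shows "uniformly_continuous_map (simplex_metric k) (cylinder_metric (simplex_metric n)) s"
proof (rule continuous_imp_uniformly_continuous_map, rule conjI)
  show "compact_space (mtopology_of (simplex_metric k))"
    by (simp add: mtopology_of_simplex_metric compact_space_subtopology compactin_standard_simplex)
  show "continuous_map (mtopology_of (simplex_metric k))
      (mtopology_of (cylinder_metric (simplex_metric n))) s"
    using assms by (simp add: singular_simplex_def cylinder_def mtopology_of_simplex_metric mtopology_of_submetric)
qed

text \<open>
  Two nearby points have images under \<open>s\<close> that are close in both factors.  Then \<open>\<sigma>\<close> contributes at
  most \<open>e < \<epsilon>\<close>, and the interval coordinate, which is genuinely continuous, at most \<open>\<epsilon>\<close>.
  The factor 2 only has to be a constant, since \<open>\<epsilon>\<close> can be chosen small.
\<close>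

lemma eps_continuous_map_cylinder:
  assumes \<sigma>: "eps_continuous_map \<epsilon> D X \<sigma>" and "0 < \<epsilon>"
    and s: "uniformly_continuous_map E (cylinder_metric D) s"
  shows "eps_continuous_map (2 * \<epsilon>) E (cylinder_metric X) (map_prod \<sigma> id \<circ> s)"
proof -
  obtain \<delta> e where "0 < \<delta>" "e < \<epsilon>" and \<delta>:
    "\<And>x y. \<lbrakk>x \<in> mspace D; y \<in> mspace D; mdist D x y < \<delta>\<rbrakk> \<Longrightarrow> mdist X (\<sigma> x) (\<sigma> y) \<le> e"
    using \<sigma> by (auto simp: eps_continuous_map_iff)
  have sE: "s \<in> mspace E \<rightarrow> mspace D \<times> {0..1}"
    using s by (auto simp: uniformly_continuous_map_def)
  have "0 < min \<delta> \<epsilon>" using \<open>0 < \<delta>\<close> \<open>0 < \<epsilon>\<close> by simp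
  then obtain \<delta>' where "0 < \<delta>'" and \<delta>': "\<And>x y. \<lbrakk>x \<in> mspace E; y \<in> mspace E; mdist E y x < \<delta>'\<rbrakk>
      \<Longrightarrow> mdist (cylinder_metric D) (s y) (s x) < min \<delta> \<epsilon>"
    using s unfolding uniformly_continuous_map_def by meson
  have "mdist (cylinder_metric X) ((map_prod \<sigma> id \<circ> s) x) ((map_prod \<sigma> id \<circ> s) y) \<le> e + \<epsilon>"
    if xy: "x \<in> mspace E" "y \<in> mspace E" "mdist E x y < \<delta>'" for x y
  proof -
    obtain a t b u where st: "s x = (a, t)" "s y = (b, u)" by fastforce
    have mem: "a \<in> mspace D" "b \<in> mspace D" "t \<in> {0..1}" "u \<in> {0..1}"
      using funcset_mem [OF sE xy(1)] funcset_mem [OF sE xy(2)] by (auto simp: st)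
    have d: "prod_dist (mdist D) dist (a, t) (b, u) < min \<delta> \<epsilon>"
      using \<delta>' [of y x] xy by (simp add: st)
    have "mdist D a b \<le> prod_dist (mdist D) dist (a, t) (b, u)"
      "dist t u \<le> prod_dist (mdist D) dist (a, t) (b, u)"
      by (auto simp: prod_dist_def)
    with d have "mdist D a b < \<delta>" "dist t u < \<epsilon>" by auto
    with mem have "mdist X (\<sigma> a) (\<sigma> b) \<le> e" "dist t u \<le> \<epsilon>"
      by (auto intro: \<delta>)
    moreover have "prod_dist (mdist X) dist (\<sigma> a, t) (\<sigma> b, u) \<le> mdist X (\<sigma> a) (\<sigma> b) + dist t u"
      by (simp add: prod_dist_def sqrt_sum_squares_le_sum)
    ultimately show ?thesis
      by (simp add: st)
  qed
  moreover have "map_prod \<sigma> id \<circ> s \<in> mspace E \<rightarrow> mspace (cylinder_metric X)"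
    using sE \<sigma> by (fastforce simp: eps_continuous_map_def Pi_iff)
  moreover have "e + \<epsilon> < 2 * \<epsilon>" using \<open>e < \<epsilon>\<close> by simp
  ultimately show ?thesis
    unfolding eps_continuous_map_iff using \<open>0 < \<delta>'\<close> by blast
qed

lemma keys_cylinder_extend:
  assumes p: "singular_chain m (cylinder n) p" and "0 < \<epsilon>"
    and c: "Poly_Mapping.keys c \<subseteq> eps_simplex_set n \<epsilon> X"
  shows "Poly_Mapping.keys (cylinder_extend m p c) \<subseteq> eps_simplex_set m (2 * \<epsilon>) (cylinder_metric X)"
proof -
  have "simplex_map m (map_prod \<sigma> id) s \<in> eps_simplex_set m (2 * \<epsilon>) (cylinder_metric X)"
    if "\<sigma> \<in> eps_simplex_set n \<epsilon> X" "singular_simplex m (cylinder n) s" for \<sigma> s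
  proof -
    have "eps_continuous_map (2 * \<epsilon>) (simplex_metric m) (cylinder_metric X) (map_prod \<sigma> id \<circ> s)"
      using that \<open>0 < \<epsilon>\<close>
      by (intro eps_continuous_map_cylinder [where D = "simplex_metric n"]
          singular_simplex_cylinder_uniformly_continuous) (auto simp: eps_simplex_set_def)
    then show ?thesis
      by (simp add: eps_simplex_set_def eps_continuous_map_iff simplex_map_def Pi_iff)
  qed
  then have *: "Poly_Mapping.keys (chain_map m (map_prod \<sigma> id) p)
      \<subseteq> eps_simplex_set m (2 * \<epsilon>) (cylinder_metric X)" if "\<sigma> \<in> eps_simplex_set n \<epsilon> X" for \<sigma>
    using that p keys_frag_extend [of "frag_of \<circ> simplex_map m (map_prod \<sigma> id)" p]
    unfolding chain_map_def singular_chain_def by fastforce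
  show ?thesis
    using keys_frag_extend [of "\<lambda>\<sigma>. chain_map m (map_prod \<sigma> id) p" c] * c
    unfolding cylinder_extend_def by blast
qed

lemma keys_chain_map_admissible:
  assumes "eps_admissible X Y f \<epsilon> \<eta>" "Poly_Mapping.keys c \<subseteq> eps_simplex_set n \<epsilon> X"
  shows "Poly_Mapping.keys (chain_map n f c) \<subseteq> eps_simplex_set n \<eta> Y"
  using keys_frag_extend [of "frag_of \<circ> simplex_map n f" c] assms
  unfolding chain_map_def eps_admissible_def by fastforce

section \<open>Homotopy invariance\<close>

text \<open>
  The witness is the image under \<open>F\<close> of the chain swept out by \<open>c\<close>.  Its sides come from \<open>\<partial>c\<close> and
  vanish because \<open>c\<close> is a cycle.
\<close>

lemma homotopic_images_of_cycle_differ_by_boundary: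
  assumes F: "eps_admissible (cylinder_metric X) Y F (2 * \<epsilon>) \<eta>" and "0 < \<epsilon>"
    and c: "Poly_Mapping.keys c \<subseteq> eps_simplex_set n \<epsilon> X" and cyc: "chain_boundary n c = 0"
  shows "chain_map n (\<lambda>x. F (x, 1)) c - chain_map n (\<lambda>x. F (x, 0)) c \<in> eps_boundaries n \<eta> Y"
proof -
  obtain p q where p: "singular_chain (Suc n) (cylinder n) p"
    and q: "singular_chain n (cylinder (n - 1)) q" and pq: "prism_relation n p q"
    using ex_prism_chain by blast
  let ?d = "chain_map (Suc n) F (cylinder_extend (Suc n) p c)"
  have "chain_boundary (Suc n) ?d
      = chain_map n F (chain_boundary (Suc n) (cylinder_extend (Suc n) p c))"
    by (simp add: chain_boundary_chain_map')
  also have "chain_boundary (Suc n) (cylinder_extend (Suc n) p c)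
      = chain_map n (\<lambda>x. (x, 1)) c - chain_map n (\<lambda>x. (x, 0)) c"
    using c cyc chain_boundary_cylinder_extend [OF q pq, of c] by (auto simp: eps_simplex_set_def)
  also have "chain_map n F \<dots> = chain_map n (\<lambda>x. F (x, 1)) c - chain_map n (\<lambda>x. F (x, 0)) c"
    using chain_map_compose [of n F "\<lambda>x. (x, 1)"] chain_map_compose [of n F "\<lambda>x. (x, 0)"]
    by (simp add: chain_map_diff o_def fun_eq_iff)
  finally have "chain_boundary (Suc n) ?d
      = chain_map n (\<lambda>x. F (x, 1)) c - chain_map n (\<lambda>x. F (x, 0)) c" .
  moreover have "?d \<in> carrier (eps_chain_group (Suc n) \<eta> Y)"
    unfolding carrier_eps_chain_group
    using keys_chain_map_admissible [OF F keys_cylinder_extend [OF p \<open>0 < \<epsilon>\<close> c]] by simp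
  ultimately show ?thesis
    unfolding eps_boundaries_def by (metis image_eqI)
qed

lemma chain_map_eq_on_eps_chain:
  assumes c: "Poly_Mapping.keys c \<subseteq> eps_simplex_set n \<epsilon> X" and "\<And>x. x \<in> mspace X \<Longrightarrow> f x = g x"
  shows "chain_map n f c = chain_map n g c"
  using c
proof (induction c rule: frag_induction)
  case (one \<sigma>)
  then have "simplex_map n f \<sigma> = simplex_map n g \<sigma>"
    using assms(2) by (auto simp: simplex_map_def eps_simplex_set_def eps_continuous_map_def fun_eq_iff Pi_iff)
  then show ?case by simp
qed (auto simp: chain_map_diff)

lemma eps_homology_group_representative:
  assumes "A \<in> carrier (eps_homology_group n \<epsilon> X)"
  obtains c where "A = eps_homology_class n \<epsilon> X c"
    "Poly_Mapping.keys c \<subseteq> eps_simplex_set n \<epsilon> X" "chain_boundary n c = 0"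
proof -
  obtain c where "c \<in> carrier (eps_cycle_group n \<epsilon> X)" "A = eps_homology_class n \<epsilon> X c"
    using assms by (auto simp: eps_homology_group_def FactGroup_def RCOSETS_def eps_homology_class_def)
  then show thesis
    by (intro that) (auto simp: eps_cycle_group_def kernel_def carrier_eps_chain_group,
        simp add: eps_chain_group_def free_Abelian_group_def)
qed

theorem theorem2p6:
  fixes X :: "'a metric" and Y :: "'b metric" and f g :: "'a \<Rightarrow> 'b"
  assumes "uniformly_continuous_map X Y f"
    and "uniformly_continuous_map X Y g"
    and "uniformly_homotopic X Y f g"
  shows "\<forall>n. lc_hom_induced n X Y f = lc_hom_induced n X Y g"
proof
  fix n
  obtain h :: "real \<Rightarrow> 'a \<Rightarrow> 'b" where h0: "\<And>x. x \<in> mspace X \<Longrightarrow> h 0 x = f x"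
    and h1: "\<And>x. x \<in> mspace X \<Longrightarrow> h 1 x = g x"
    and h: "uniformly_continuous_map (cylinder_metric X) Y (\<lambda>(x, t). h t x)"
    using assms(3) unfolding uniformly_homotopic_def by blast
  have "lc_hom_induced n X Y f a \<eta> = lc_hom_induced n X Y g a \<eta>"
    if a: "a \<in> carrier (lc_homology_group n X)" and "0 < \<eta>" for a \<eta>
  proof -
    obtain \<mu> \<epsilon>f \<epsilon>g where \<mu>: "eps_admissible (cylinder_metric X) Y (\<lambda>(x, t). h t x) \<mu> \<eta>"
      and \<epsilon>f: "eps_admissible X Y f \<epsilon>f \<eta>" and \<epsilon>g: "eps_admissible X Y g \<epsilon>g \<eta>"
      using ex_eps_admissible [OF h \<open>0 < \<eta>\<close>] ex_eps_admissible [OF assms(1) \<open>0 < \<eta>\<close>]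
        ex_eps_admissible [OF assms(2) \<open>0 < \<eta>\<close>] by blast
    \<comment> \<open>A single scale at which \<open>f\<close>, \<open>g\<close> and, after the doubling caused by sweeping, the homotopy can be applied.\<close>
    define \<epsilon> where "\<epsilon> = min (\<mu> / 2) (min \<epsilon>f \<epsilon>g)"
    have "0 < \<epsilon>"
      using \<mu> \<epsilon>f \<epsilon>g by (simp add: \<epsilon>_def eps_admissible_def)
    have adm: "eps_admissible (cylinder_metric X) Y (\<lambda>(x, t). h t x) (2 * \<epsilon>) \<eta>"
      "eps_admissible X Y f \<epsilon> \<eta>" "eps_admissible X Y g \<epsilon> \<eta>"
      using \<open>0 < \<epsilon>\<close> by (auto intro: eps_admissible_mono [OF \<mu>] eps_admissible_mono [OF \<epsilon>f]
          eps_admissible_mono [OF \<epsilon>g] simp: \<epsilon>_def)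
    have "a \<epsilon> \<in> carrier (eps_homology_group n \<epsilon> X)"
      using a \<open>0 < \<epsilon>\<close> by (auto simp: lc_homology_group_def)
    then obtain c where ac: "a \<epsilon> = eps_homology_class n \<epsilon> X c"
      and c: "Poly_Mapping.keys c \<subseteq> eps_simplex_set n \<epsilon> X" and cyc: "chain_boundary n c = 0"
      by (rule eps_homology_group_representative)
    have "chain_map n g c - chain_map n f c = chain_map n (h 1) c - chain_map n (h 0) c"
      using chain_map_eq_on_eps_chain [OF c h0] chain_map_eq_on_eps_chain [OF c h1] by simp
    also have "\<dots> \<in> eps_boundaries n \<eta> Y"
      using homotopic_images_of_cycle_differ_by_boundary [OF adm(1) \<open>0 < \<epsilon>\<close> c cyc] by simp
    finally have "eps_homology_class n \<eta> Y (chain_map n g c) = eps_homology_class n \<eta> Y (chain_map n f c)"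
      by (rule eps_homology_class_cong)
    then show ?thesis
      by (simp add: lc_hom_induced_apply [OF a \<open>0 < \<eta>\<close> adm(2)] lc_hom_induced_apply [OF a \<open>0 < \<eta>\<close> adm(3)]
          ac eps_hom_induced_chain_map [OF adm(2)] eps_hom_induced_chain_map [OF adm(3)])
  qed
  then show "lc_hom_induced n X Y f = lc_hom_induced n X Y g"
    by (auto simp: lc_hom_induced_def fun_eq_iff restrict_def)
qed

end
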